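(* Let $T_n=T_n(\mathbf{Y}_n)$ be a real-valued test statistic with CDF $G_n(t\mid\theta)=P_\theta^n(T_n\le t)$ under $P_\theta^n$, and let $T$ be a random variable with continuous CDF. Suppose that for every sequence $(\theta_n)\subset\Theta$ with $\|\theta_n-\theta_0\|=O(1/\sqrt n)$, the statistic $T_n$ converges in distribution to $T$ under $P_{\theta_n}^n$. Then both of the following hold: (P2) under $P_{\theta_0}^n$, $T_n$ converges in distribution to a random variable with continuous CDF; (P3) for every $c\in\mathbb{R}$, $\ \sup_{\theta\in A_n(c),\,t\in\mathbb{R}}|G_n(t\mid\theta)-G_n(t\mid\theta_0)|\to0$ as $n\to\infty$, where $A_n(c):=\{\theta\in\Theta:\|\theta-\theta_0\|\le c/\sqrt n\}$.
   Context: For each $n$, $\mathbf{Y}_n\in\mathbb{R}^n$ is a random data vector modeled as $\mathbf{Y}_n\sim P_\theta^n$ with $\theta\in\Theta\subset\mathbb{R}^k$; $\theta_0$ is a fixed interior point of $\Theta$ (the true parameter). The limit $T$ is the same for all sequences $(\theta_n)$. *)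

theory Defs
  imports "HOL-Probability.Probability" "HOL-Library.Landau_Symbols"
begin

text \<open>Since the dimension of the sample space varies with the sample size, \<open>\<real>\<^sup>n\<close> is
  represented by the product space of \<open>n\<close> copies of the Borel line, whose points are
  functions on the index set \<open>{..<n}\<close>.\<close>

definition sample_space :: "nat \<Rightarrow> (nat \<Rightarrow> real) measure" where
  "sample_space n = (\<Pi>\<^sub>M i\<in>{..<n}. borel)"

definition stat_cdf ::
  "(nat \<Rightarrow> 'p \<Rightarrow> (nat \<Rightarrow> real) measure) \<Rightarrow> (nat \<Rightarrow> (nat \<Rightarrow> real) \<Rightarrow> real) \<Rightarrow> nat \<Rightarrow> real \<Rightarrow> 'p \<Rightarrow> real"
  where "stat_cdf P Tn n t \<theta> = \<P>(y in P n \<theta>. Tn n y \<le> t)"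

definition converges_in_distribution ::
  "(nat \<Rightarrow> 'a measure) \<Rightarrow> (nat \<Rightarrow> 'a \<Rightarrow> real) \<Rightarrow> 'b measure \<Rightarrow> ('b \<Rightarrow> real) \<Rightarrow> bool"
  where "converges_in_distribution M X N Z \<longleftrightarrow>
    weak_conv_m (\<lambda>n. distr (M n) borel (X n)) (distr N borel Z)"

text \<open>Every real law is the law of the identity on the real line, so an existentially
  quantified limit variable may be taken on a probability space over \<open>real\<close>.\<close>

text \<open>For \<open>c < 0\<close> and \<open>n > 0\<close> the following set is empty. Suprema over it are therefore taken in
  \<open>ennreal\<close>, where the empty supremum is \<open>0\<close>.\<close>

definition local_nbhd :: "(real ^ 'k) set \<Rightarrow> real ^ 'k \<Rightarrow> real \<Rightarrow> nat \<Rightarrow> (real ^ 'k) set" where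
  "local_nbhd \<Theta> \<theta>0 c n = {\<theta> \<in> \<Theta>. norm (\<theta> - \<theta>0) \<le> c / sqrt (real n)}"

end

theory Submission
  imports Defs
begin

text \<open>By Polya's theorem, pointwise convergence of distribution functions to a continuous
  distribution function is uniform. If the supremum in (P3) did not tend to \<open>0\<close>, then parameters
  \<open>\<theta>\<^sub>n \<in> A\<^sub>n(c)\<close> that nearly attain it would form a sequence at distance \<open>O(1/\<surd>n)\<close> from \<open>\<theta>\<^sub>0\<close> along which
  the distribution functions stay away from those at \<open>\<theta>\<^sub>0\<close>, although both converge
  uniformly to the distribution function of \<open>T\<close>.\<close>

text \<open>This is the intermediate value theorem: the limits at both ends supply points where
  \<open>F\<close> lies below and above \<open>y\<close>. The values 0 and 1 are left out because
  they need not be attained. It supplies the quantiles used as grid points in Polya's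
  theorem.\<close>

lemma continuous_distribution_function_surj:
  fixes F :: "real \<Rightarrow> real"
  assumes cont: "continuous_on UNIV F"
    and bot: "(F \<longlongrightarrow> 0) at_bot" and top: "(F \<longlongrightarrow> 1) at_top"
    and y: "0 < y" "y < 1"
  obtains x where "F x = y"
proof -
  obtain a where a: "F a < y"
    using eventually_happens'[OF _ order_tendstoD(2)[OF bot y(1)]] by auto
  obtain b where b: "y < F b"
    using eventually_happens'[OF _ order_tendstoD(1)[OF top y(2)]] by auto
  have "connected (range F)"
    using cont by (intro connected_continuous_image) auto
  then have "y \<in> range F"
    using connected_contains_Icc[of "range F" "F a" "F b"] a b by auto
  with that show thesis by auto
qed

text \<open>Quantiles of \<open>F\<close> at the levels \<open>k / m\<close> form a finite grid, on
  which pointwise convergence is uniform. Between grid points \<open>F\<close> grows by at most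
  \<open>1 / m\<close>, and monotonicity of \<open>Fn n\<close> carries the estimate over to all
  \<open>t\<close>.\<close>

lemma Polya_uniform_limit:
  fixes F :: "real \<Rightarrow> real" and Fn :: "'i \<Rightarrow> real \<Rightarrow> real"
  assumes cont: "continuous_on UNIV F" and mono: "mono F"
    and bot: "(F \<longlongrightarrow> 0) at_bot" and top: "(F \<longlongrightarrow> 1) at_top"
    and Fn: "eventually (\<lambda>n. mono (Fn n) \<and> (\<forall>t. 0 \<le> Fn n t \<and> Fn n t \<le> 1)) \<F>"
    and lim: "\<And>t. ((\<lambda>n. Fn n t) \<longlongrightarrow> F t) \<F>"
  shows "uniform_limit UNIV Fn F \<F>"
proof (rule uniform_limitI)
  fix e :: real assume "e > 0"
  \<comment> \<open>The errors below are at most \<open>2 / m\<close> from above and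
    \<open>3 / m\<close> from below, so \<open>4 / m < e\<close> leaves room for a strict
    inequality.\<close>
  then obtain m :: nat where m: "real m > 4 / e" "m > 0"
    using reals_Archimedean2[of "4 / e"]
    using \<open>e > 0\<close> by (metis divide_pos_pos less_trans of_nat_0_less_iff zero_less_numeral)
  have em: "4 / real m < e"
    using m \<open>e > 0\<close> by (simp add: field_simps)
  have "\<exists>x. F x = real k / real m" if "k \<in> {1..<m}" for k
    by (rule continuous_distribution_function_surj[OF cont bot top, of "real k / real m"])
       (use that in auto)
  then obtain x where x: "\<And>k. k \<in> {1..<m} \<Longrightarrow> F (x k) = real k / real m"
    by metis
  have "eventually (\<lambda>n. \<forall>k\<in>{1..<m}. dist (Fn n (x k)) (F (x k)) < 1 / real m) \<F>"
    using m by (intro eventually_ball_finite ballI tendstoD lim) auto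
  with Fn show "eventually (\<lambda>n. \<forall>t\<in>UNIV. dist (Fn n t) (F t) < e) \<F>"
  proof eventually_elim
    case (elim n)
    then have mn: "mono (Fn n)" and Fn0: "\<And>t. 0 \<le> Fn n t" and Fn1: "\<And>t. Fn n t \<le> 1"
      and near: "\<And>k. k \<in> {1..<m} \<Longrightarrow> \<bar>Fn n (x k) - real k / real m\<bar> < 1 / real m"
      by (auto simp: dist_real_def x)
    show ?case
    proof
      fix t
      have F01: "0 \<le> F t" "F t \<le> 1"
        by (rule tendsto_upperbound[OF bot eventually_at_bot_linorderI[of t]],
            auto intro: monoD[OF mono])
           (rule tendsto_lowerbound[OF top eventually_at_top_linorderI[of t]],
            auto intro: monoD[OF mono])
      define j where "j = nat \<lfloor>real m * F t\<rfloor>"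
      have "real j = of_int \<lfloor>real m * F t\<rfloor>"
        using F01 by (simp add: j_def)
      then have "real j \<le> real m * F t" "real m * F t < real j + 1"
        by linarith+
      then have j: "real j / real m \<le> F t" "F t < (real j + 1) / real m"
        using m by (auto simp: field_simps)
      \<comment> \<open>The grid point of level \<open>j + 1\<close> lies to the right of
        \<open>t\<close>; one \<open>1 / m\<close> is the gap between levels, the other the error at
        that point. If the level is too high for the grid, \<open>F t\<close> is at least
        \<open>1 - 1 / m\<close> and the bound \<open>Fn n t \<le> 1\<close> suffices.\<close>
      have "Fn n t \<le> F t + 2 / real m"
      proof (cases "j + 1 < m")
        case True
        then have k: "j + 1 \<in> {1..<m}" by auto
        have "F t < F (x (j + 1))"
          using j x[OF k] by (simp add: add.commute)
        then have "t \<le> x (j + 1)"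
          using mono by (meson mono_def not_le less_imp_le)
        then have "Fn n t \<le> Fn n (x (j + 1))"
          using mn by (simp add: mono_def)
        with near[OF k] j show ?thesis
          by (simp add: add_divide_distrib)
      next
        case False
        then have "real m \<le> real j + 1" by linarith
        then have "1 \<le> real j / real m + 1 / real m"
          using m by (simp add: field_simps)
        moreover have "0 \<le> 1 / real m" "2 / real m = 1 / real m + 1 / real m" by auto
        ultimately show ?thesis using Fn1[of t] j by linarith
      qed
      \<comment> \<open>Level \<open>j - 1\<close> is used instead of \<open>j\<close>: since
        \<open>F t\<close> may equal \<open>j / m\<close>, only the lower level gives the strict
        inequality that places the grid point to the left of \<open>t\<close>. This costs the third
        \<open>1 / m\<close>. For \<open>j < 2\<close> the left side is not positive.\<close>
      moreover have "F t - 3 / real m \<le> Fn n t"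
      proof (cases "j \<ge> 2")
        case True
        have "real m * F t \<le> real m" using F01 by (simp add: mult_left_le)
        with \<open>real j \<le> real m * F t\<close> have "real j \<le> real m" by linarith
        with True have k: "j - 1 \<in> {1..<m}" by auto
        have j1: "real (j - 1) / real m = real j / real m - 1 / real m"
          using True by (simp add: of_nat_diff diff_divide_distrib)
        have "0 < 1 / real m" using m by simp
        then have "F (x (j - 1)) < F t"
          using j x[OF k] j1 by linarith
        then have "x (j - 1) \<le> t"
          using mono by (meson mono_def not_le less_imp_le)
        then have "Fn n (x (j - 1)) \<le> Fn n t"
          using mn by (simp add: mono_def)
        with near[OF k] j j1 show ?thesis
          by (simp add: add_divide_distrib)
      next
        case False
        then have "(real j + 1) / real m \<le> 3 / real m"
          using m by (intro divide_right_mono) auto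
        with Fn0[of t] j show ?thesis by linarith
      qed
      moreover have "2 / real m \<le> 4 / real m" "3 / real m < 4 / real m"
        using m by (auto simp: divide_simps)
      ultimately show "dist (Fn n t) (F t) < e"
        using em by (simp add: dist_real_def abs_if)
    qed
  qed
qed

text \<open>Weak convergence gives convergence at the continuity points of the limit, here all of
  the real line, so Polya's theorem applies. Asking for distributions only eventually allows for the
  index 0, where nothing is known about the model.\<close>

lemma weak_conv_m_uniform_limit_cdf:
  assumes conv: "weak_conv_m \<mu> N"
    and \<mu>: "eventually (\<lambda>n. real_distribution (\<mu> n)) sequentially"
    and N: "real_distribution N" and cont: "continuous_on UNIV (cdf N)"
  shows "uniform_limit UNIV (\<lambda>n. cdf (\<mu> n)) (cdf N) sequentially"
proof (rule Polya_uniform_limit[OF cont])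
  interpret N: real_distribution N by fact
  show "mono (cdf N)"
    by (simp add: mono_def N.cdf_nondecreasing)
  show "(cdf N \<longlongrightarrow> 0) at_bot" by (rule N.cdf_lim_at_bot)
  show "(cdf N \<longlongrightarrow> 1) at_top" by (rule N.cdf_lim_at_top_prob)
  show "eventually (\<lambda>n. mono (cdf (\<mu> n)) \<and> (\<forall>t. 0 \<le> cdf (\<mu> n) t \<and> cdf (\<mu> n) t \<le> 1)) sequentially"
    using \<mu>
  proof eventually_elim
    case (elim n)
    then interpret n: real_distribution "\<mu> n" .
    show ?case
      by (auto simp: mono_def n.cdf_nondecreasing n.cdf_nonneg n.cdf_bounded_prob)
  qed
  show "(\<lambda>n. cdf (\<mu> n) t) \<longlonglongrightarrow> cdf N t" for t
    using conv cont by (simp add: weak_conv_m_def weak_conv_def continuous_on_eq_continuous_at)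
qed

theorem lemma2:
  fixes \<Theta> :: "(real ^ 'k) set" and \<theta>0 :: "real ^ 'k"
    and P :: "nat \<Rightarrow> real ^ 'k \<Rightarrow> (nat \<Rightarrow> real) measure"
    and Tn :: "nat \<Rightarrow> (nat \<Rightarrow> real) \<Rightarrow> real"
    and M :: "'w measure" and T :: "'w \<Rightarrow> real"
  assumes "\<theta>0 \<in> interior \<Theta>"
    and "\<And>n \<theta>. n \<ge> 1 \<Longrightarrow> \<theta> \<in> \<Theta> \<Longrightarrow> prob_space (P n \<theta>)"
    and "\<And>n \<theta>. n \<ge> 1 \<Longrightarrow> \<theta> \<in> \<Theta> \<Longrightarrow> sets (P n \<theta>) = sets (sample_space n)"
    and "\<And>n. n \<ge> 1 \<Longrightarrow> Tn n \<in> borel_measurable (sample_space n)"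
    and "prob_space M" and "T \<in> borel_measurable M"
    and "continuous_on UNIV (cdf (distr M borel T))"
    and "\<And>\<theta>s :: nat \<Rightarrow> real ^ 'k. (\<And>n. \<theta>s n \<in> \<Theta>) \<Longrightarrow>
           (\<lambda>n. norm (\<theta>s n - \<theta>0)) \<in> O(\<lambda>n. 1 / sqrt (real n)) \<Longrightarrow>
           converges_in_distribution (\<lambda>n. P n (\<theta>s n)) Tn M T"
  shows "(\<exists>(N :: real measure) Z. prob_space N \<and> Z \<in> borel_measurable N \<and>
            continuous_on UNIV (cdf (distr N borel Z)) \<and>
            converges_in_distribution (\<lambda>n. P n \<theta>0) Tn N Z)
       \<and> (\<forall>c :: real.
            (\<lambda>n. SUP (\<theta>, t) \<in> local_nbhd \<Theta> \<theta>0 c n \<times> (UNIV :: real set).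
                   ennreal \<bar>stat_cdf P Tn n t \<theta> - stat_cdf P Tn n t \<theta>0\<bar>) \<longlonglongrightarrow> 0)"
proof (intro conjI allI)
  interpret M: prob_space M by fact
  define F where "F = cdf (distr M borel T)"
  have \<theta>0: "\<theta>0 \<in> \<Theta>"
    using assms(1) interior_subset by blast
  have N: "real_distribution (distr M borel T)"
    using assms(6) by (rule M.real_distribution_distr)
  have meas: "Tn n \<in> borel_measurable (P n \<theta>)" if "n \<ge> 1" "\<theta> \<in> \<Theta>" for n \<theta>
    using assms(3)[OF that] assms(4)[OF that(1)] measurable_cong_sets by blast
  have cdf_eq: "cdf (distr (P n \<theta>) borel (Tn n)) t = stat_cdf P Tn n t \<theta>"
    if "n \<ge> 1" "\<theta> \<in> \<Theta>" for n \<theta> t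
    using meas[OF that]
    by (auto simp: cdf_def measure_distr stat_cdf_def intro!: arg_cong[where f = "measure _"])
  have unif: "uniform_limit UNIV (\<lambda>n t. stat_cdf P Tn n t (\<theta>s n)) F sequentially"
    if \<theta>s: "\<And>n. \<theta>s n \<in> \<Theta>"
      and O: "(\<lambda>n. norm (\<theta>s n - \<theta>0)) \<in> O(\<lambda>n. 1 / sqrt (real n))" for \<theta>s
  proof -
    have "real_distribution (distr (P n (\<theta>s n)) borel (Tn n))" if "n \<ge> 1" for n
      using assms(2) meas \<theta>s that by (blast intro: prob_space.real_distribution_distr)
    then have "uniform_limit UNIV (\<lambda>n. cdf (distr (P n (\<theta>s n)) borel (Tn n))) F sequentially"
      using assms(8)[OF \<theta>s O] N assms(7) unfolding F_def converges_in_distribution_def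
      by (intro weak_conv_m_uniform_limit_cdf) (auto intro: eventually_sequentiallyI)
    also have "?this \<longleftrightarrow> ?thesis"
      using \<theta>s cdf_eq by (intro uniform_limit_cong eventually_sequentiallyI[of 1]) auto
    finally show ?thesis .
  qed
  have O0: "(\<lambda>n. norm (\<theta>0 - \<theta>0)) \<in> O(\<lambda>n. 1 / sqrt (real n))"
    by simp

  show "\<exists>(N :: real measure) Z. prob_space N \<and> Z \<in> borel_measurable N \<and>
      continuous_on UNIV (cdf (distr N borel Z)) \<and> converges_in_distribution (\<lambda>n. P n \<theta>0) Tn N Z"
  proof (intro exI conjI)
    let ?N = "distr M borel T" and ?Z = "\<lambda>x::real. x"
    have eq: "distr ?N borel ?Z = ?N"
      by (rule distr_id2) simp
    show "prob_space ?N" by (rule M.prob_space_distr) fact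
    show "?Z \<in> borel_measurable ?N" by simp
    show "continuous_on UNIV (cdf (distr ?N borel ?Z))" using assms(7) eq by simp
    show "converges_in_distribution (\<lambda>n. P n \<theta>0) Tn ?N ?Z"
      using assms(8)[of "\<lambda>_. \<theta>0", OF \<theta>0 O0] by (simp add: converges_in_distribution_def eq)
  qed

  fix c :: real
  let ?d = "\<lambda>n \<theta> t. \<bar>stat_cdf P Tn n t \<theta> - stat_cdf P Tn n t \<theta>0\<bar>"
  let ?S = "\<lambda>n. SUP (\<theta>, t) \<in> local_nbhd \<Theta> \<theta>0 c n \<times> (UNIV :: real set). ennreal (?d n \<theta> t)"
  have small: "eventually (\<lambda>n. ?S n \<le> ennreal e) sequentially" if "e > 0" for e
  proof -
    define bad where "bad n \<theta> \<longleftrightarrow> \<theta> \<in> local_nbhd \<Theta> \<theta>0 c n \<and> (\<exists>t. e < ?d n \<theta> t)" for n \<theta>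
    \<comment> \<open>Violating parameters are collected into one sequence; the default
      \<open>\<theta>0\<close> keeps it in \<open>\<Theta>\<close> and local at every index without
      a violation.\<close>
    define \<theta>s where "\<theta>s n = (if \<exists>\<theta>. bad n \<theta> then SOME \<theta>. bad n \<theta> else \<theta>0)" for n
    have bad: "bad n (\<theta>s n)" if "bad n \<theta>" for n \<theta>
      using that someI[of "bad n" \<theta>] by (auto simp: \<theta>s_def)
    have \<theta>s_cases: "bad n (\<theta>s n) \<or> \<theta>s n = \<theta>0" for n
      using bad by (metis \<theta>s_def)
    have in\<Theta>: "\<theta>s n \<in> \<Theta>" for n
      using \<theta>s_cases[of n] \<theta>0 by (auto simp: bad_def local_nbhd_def)
    \<comment> \<open>The absolute value is for negative \<open>c\<close>, where the default
      \<open>\<theta>0\<close> at distance 0 would break the bound with \<open>c\<close>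
      itself.\<close>
    have "norm (\<theta>s n - \<theta>0) \<le> \<bar>c\<bar> * (1 / sqrt (real n))" for n
    proof -
      have "c / sqrt (real n) \<le> \<bar>c\<bar> / sqrt (real n)"
        by (intro divide_right_mono) auto
      with \<theta>s_cases[of n] show ?thesis by (auto simp: bad_def local_nbhd_def)
    qed
    then have "(\<lambda>n. norm (\<theta>s n - \<theta>0)) \<in> O(\<lambda>n. 1 / sqrt (real n))"
      by (intro bigoI[of _ "\<bar>c\<bar>"]) auto
    from uniform_limitD[OF unif[of \<theta>s, OF in\<Theta> this], of "e / 2"]
      uniform_limitD[OF unif[of "\<lambda>_. \<theta>0", OF \<theta>0 O0], of "e / 2"] \<open>e > 0\<close>
    have "eventually (\<lambda>n. \<forall>t\<in>UNIV. dist (stat_cdf P Tn n t (\<theta>s n)) (F t) < e / 2) sequentially"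
      "eventually (\<lambda>n. \<forall>t\<in>UNIV. dist (stat_cdf P Tn n t \<theta>0) (F t) < e / 2) sequentially"
      by auto
    then show ?thesis
    proof eventually_elim
      case (elim n)
      have "?d n (\<theta>s n) t < e" for t
        using elim dist_triangle_half_l[of "stat_cdf P Tn n t (\<theta>s n)" "F t" e "stat_cdf P Tn n t \<theta>0"]
        by (simp add: dist_real_def)
      then have "\<not> bad n (\<theta>s n)"
        by (auto simp: bad_def not_less intro: less_imp_le)
      \<comment> \<open>Any violation at \<open>n\<close> would have made the chosen parameter a
        violation too, so its absence bounds the whole supremum by \<open>e\<close>.\<close>
      then have "\<not> bad n \<theta>" for \<theta>
        using bad by blast
      then show ?case
        by (auto simp: bad_def not_less intro!: SUP_least ennreal_leI)
    qed
  qed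
  show "?S \<longlonglongrightarrow> 0"
  proof (rule order_tendstoI)
    fix a :: ennreal assume "0 < a"
    \<comment> \<open>The estimate \<open>small\<close> is not strict and needs a real bound; an
      intermediate \<open>b\<close> restores strictness and is finite even if \<open>a\<close> is
      infinite.\<close>
    then obtain b where b: "0 < b" "b < a" using dense by blast
    then have "b \<noteq> \<top>" by (metis top.extremum_strict)
    then obtain e where e: "0 \<le> e" "b = ennreal e"
      by (cases b) auto
    with b(1) have "e > 0" by simp
    from small[OF this] show "eventually (\<lambda>n. ?S n < a) sequentially"
      by eventually_elim (use b(2) e(2) in auto)
  qed simp
qed

end
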